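(* Let $\mathbf{L}=\langle L,\leq,\otimes,\rightarrow,0,1\rangle$ be a complete residuated lattice, let $K\subseteq L$ be a $\leq$-filter in $\mathbf{L}$, and let $Y\neq\emptyset$. An operator $C\colon L^Y\to L^Y$ is an $\mathbf{L}_K$-closure operator if and only if it is an $\mathbf{L}_{\{1\}}$-closure operator and $$C(a\rightarrow C(A))\subseteq a\rightarrow C(A)$$ holds for all $a\in K$ and all $A\in L^Y$.
   Context: A complete (commutative integral) residuated lattice: $\langle L,\leq\rangle$ complete lattice with bounds $0,1$, $\otimes$ associative, commutative with neutral $1$, and $a\otimes b\leq c$ iff $b\leq a\rightarrow c$. A $\leq$-filter is a nonempty $K\subseteq L$ such that $a\in K$ and $a\leq b$ imply $b\in K$. $L^Y$ is the set of maps $Y\to L$, with $A\subseteq B$ iff $A(y)\leq B(y)$ for all $y$; $(a\rightarrow A)(y)=a\rightarrow A(y)$; $S(A,B)=\bigwedge_{y\in Y}(A(y)\rightarrow B(y))$. An $\mathbf{L}_K$-closure operator is $C\colon L^Y\to L^Y$ with $A\subseteq C(A)$, $C(C(A))\subseteq C(A)$, and: if $S(A,B)\in K$ then $S(A,B)\leq S(C(A),C(B))$, for all $A,B\in L^Y$. An $\mathbf{L}_{\{1\}}$-closure operator is an ordinary closure operator on $\langle L^Y,\subseteq\rangle$ (extensive, monotone, idempotent). *)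

theory Defs
  imports Main
begin

(* The order, the lattice operations and the bounds 0 = bot, 1 = top come from the type class;
   the associative commutative multiplication and its residuum are locale parameters. *)
locale complete_residuated_lattice =
  fixes tensor :: "'l::complete_lattice \<Rightarrow> 'l \<Rightarrow> 'l" (infixl "\<otimes>" 70)
    and residuum :: "'l \<Rightarrow> 'l \<Rightarrow> 'l" (infixr "\<leadsto>" 60)
  assumes tensor_assoc: "(a \<otimes> b) \<otimes> c = a \<otimes> (b \<otimes> c)"
    and tensor_commute: "a \<otimes> b = b \<otimes> a"
    and tensor_top: "a \<otimes> top = a"
    and adjointness: "a \<otimes> b \<le> c \<longleftrightarrow> b \<le> a \<leadsto> c"

definition le_filter :: "'l::order set \<Rightarrow> bool" where
  "le_filter K \<longleftrightarrow> K \<noteq> {} \<and> (\<forall>a b. a \<in> K \<longrightarrow> a \<le> b \<longrightarrow> b \<in> K)"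

(* L-sets over a (nonempty) universe Y are functions from the type 'y; inclusion of L-sets is the
   pointwise order on functions. The residuum is passed explicitly as res. *)

definition shift :: "('l \<Rightarrow> 'l \<Rightarrow> 'l) \<Rightarrow> 'l \<Rightarrow> ('y \<Rightarrow> 'l) \<Rightarrow> 'y \<Rightarrow> 'l" where
  "shift res a A = (\<lambda>y. res a (A y))"

definition subsethood ::
    "('l::complete_lattice \<Rightarrow> 'l \<Rightarrow> 'l) \<Rightarrow> ('y \<Rightarrow> 'l) \<Rightarrow> ('y \<Rightarrow> 'l) \<Rightarrow> 'l" where
  "subsethood res A B = (INF y. res (A y) (B y))"

definition LK_closure_operator ::
    "('l::complete_lattice \<Rightarrow> 'l \<Rightarrow> 'l) \<Rightarrow> 'l set \<Rightarrow> (('y \<Rightarrow> 'l) \<Rightarrow> ('y \<Rightarrow> 'l)) \<Rightarrow> bool" where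
  "LK_closure_operator res K C \<longleftrightarrow>
     (\<forall>A. A \<le> C A) \<and>
     (\<forall>A. C (C A) \<le> C A) \<and>
     (\<forall>A B. subsethood res A B \<in> K \<longrightarrow>
        subsethood res A B \<le> subsethood res (C A) (C B))"

context complete_residuated_lattice
begin

lemma subsethood_eq_top_iff: "subsethood (\<leadsto>) A B = top \<longleftrightarrow> A \<le> B"
proof -
  have "a \<leadsto> b = top \<longleftrightarrow> a \<le> b" for a b
    using adjointness[of a top b] by (simp add: tensor_top top_unique)
  then show ?thesis
    by (auto simp: subsethood_def le_fun_def)
qed

lemma L1_closure_operator_iff:
  "LK_closure_operator (\<leadsto>) {top} C \<longleftrightarrow>
     (\<forall>A. A \<le> C A) \<and> mono C \<and> (\<forall>A. C (C A) = C A)"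
proof -
  have "(subsethood (\<leadsto>) A B \<in> {top} \<longrightarrow>
      subsethood (\<leadsto>) A B \<le> subsethood (\<leadsto>) (C A) (C B)) \<longleftrightarrow> (A \<le> B \<longrightarrow> C A \<le> C B)" for A B
    by (metis singleton_iff subsethood_eq_top_iff top_greatest top_unique)
  then show ?thesis
    unfolding LK_closure_operator_def mono_def by (metis order_antisym order_refl)
qed

end

end

theory Submission
  imports Defs
begin

context complete_residuated_lattice
begin

text \<open>The theorem rests on this Galois connection: it turns the graded monotonicity condition for
  the degree \<open>a = S(A, B)\<close> into the crisp monotonicity of \<open>C\<close> applied to \<open>A \<subseteq> a \<rightarrow> C(B)\<close>.\<close>

lemma le_subsethood_iff: "a \<le> subsethood (\<leadsto>) A B \<longleftrightarrow> A \<le> shift (\<leadsto>) a B"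
proof -
  have "a \<le> A y \<leadsto> B y \<longleftrightarrow> A y \<le> a \<leadsto> B y" for y
    by (metis adjointness tensor_commute)
  then show ?thesis
    by (simp add: subsethood_def shift_def le_fun_def le_INF_iff)
qed

lemma shift_mono: "A \<le> B \<Longrightarrow> shift (\<leadsto>) a A \<le> shift (\<leadsto>) a B"
  unfolding shift_def le_fun_def by (meson adjointness order_refl order_trans)

text \<open>\<open>K\<close> enters only through the premise of the monotonicity condition, so
  shrinking it drops instances of that condition.\<close>

lemma LK_closure_operator_antimono:
  "LK_closure_operator (\<leadsto>) K C \<Longrightarrow> K' \<subseteq> K \<Longrightarrow> LK_closure_operator (\<leadsto>) K' C"
  unfolding LK_closure_operator_def by blast

text \<open>The degree to which \<open>shift (\<leadsto>) a (C A)\<close> is included in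
  \<open>C A\<close> is at least \<open>a\<close>, hence lies in the upward closed \<open>K\<close>;
  graded monotonicity then applies to this pair, and idempotency collapses
  \<open>C (C A)\<close>.\<close>

lemma LK_closure_operator_shift:
  assumes C: "LK_closure_operator (\<leadsto>) K C" and K: "le_filter K" and "a \<in> K"
  shows "C (shift (\<leadsto>) a (C A)) \<le> shift (\<leadsto>) a (C A)"
proof -
  let ?B = "shift (\<leadsto>) a (C A)"
  \<comment> \<open>Under the Galois connection this is just \<open>?B \<le> ?B\<close>.\<close>
  have a: "a \<le> subsethood (\<leadsto>) ?B (C A)"
    by (simp add: le_subsethood_iff)
  then have "subsethood (\<leadsto>) ?B (C A) \<in> K"
    using K \<open>a \<in> K\<close> unfolding le_filter_def by blast
  then have "a \<le> subsethood (\<leadsto>) (C ?B) (C (C A))"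
    using C a unfolding LK_closure_operator_def by (meson order_trans)
  then have "C ?B \<le> shift (\<leadsto>) a (C (C A))"
    by (simp add: le_subsethood_iff)
  also have "\<dots> \<le> ?B"
    using C by (intro shift_mono) (simp add: LK_closure_operator_def)
  finally show ?thesis .
qed

text \<open>By extensivity, \<open>shift\<close> says that \<open>shift (\<leadsto>) a (C B)\<close>
  is a fixed point of \<open>C\<close> for \<open>a \<in> K\<close>; the closure of any L-set below
  it therefore stays below it.\<close>

lemma LK_closure_operatorI:
  assumes C: "LK_closure_operator (\<leadsto>) {top} C"
    and shift: "\<And>a A. a \<in> K \<Longrightarrow> C (shift (\<leadsto>) a (C A)) \<le> shift (\<leadsto>) a (C A)"
  shows "LK_closure_operator (\<leadsto>) K C"
proof -
  have ext: "A \<le> C A" and "mono C" and idem: "C (C A) = C A" for A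
    using C by (simp_all add: L1_closure_operator_iff)
  have "subsethood (\<leadsto>) A B \<le> subsethood (\<leadsto>) (C A) (C B)"
    if "subsethood (\<leadsto>) A B \<in> K" for A B
  proof -
    let ?a = "subsethood (\<leadsto>) A B"
    \<comment> \<open>The Galois connection at \<open>?a \<le> ?a\<close>.\<close>
    have "A \<le> shift (\<leadsto>) ?a B"
      using le_subsethood_iff by blast
    also have "\<dots> \<le> shift (\<leadsto>) ?a (C B)"
      by (intro shift_mono ext)
    finally have "C A \<le> C (shift (\<leadsto>) ?a (C B))"
      by (rule monoD[OF \<open>mono C\<close>])
    also have "\<dots> \<le> shift (\<leadsto>) ?a (C B)"
      using that by (rule shift)
    finally show ?thesis
      by (simp add: le_subsethood_iff)
  qed
  then show ?thesis
    by (simp add: LK_closure_operator_def ext idem)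
qed

end

theorem theorem9:
  fixes tensor :: "'l::complete_lattice \<Rightarrow> 'l \<Rightarrow> 'l"
    and res :: "'l \<Rightarrow> 'l \<Rightarrow> 'l"
    and K :: "'l set"
    and C :: "('y \<Rightarrow> 'l) \<Rightarrow> ('y \<Rightarrow> 'l)"
  assumes "complete_residuated_lattice tensor res"
    and "le_filter K"
  shows "LK_closure_operator res K C \<longleftrightarrow>
    LK_closure_operator res {top} C \<and>
    (\<forall>a\<in>K. \<forall>A. C (shift res a (C A)) \<le> shift res a (C A))"
proof -
  interpret complete_residuated_lattice tensor res by fact
  \<comment> \<open>Some element of \<open>K\<close> exists and lies below \<open>top\<close>, so
    the ordinary closure property is the restriction of the graded one to
    \<open>{top}\<close>.\<close>
  have "{top} \<subseteq> K"
    using \<open>le_filter K\<close> unfolding le_filter_def by (auto intro: top_greatest)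
  then show ?thesis
    using LK_closure_operator_antimono LK_closure_operator_shift[OF _ \<open>le_filter K\<close>]
      LK_closure_operatorI by meson
qed

end
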